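(* Let $\{A,G,\sigma,\alpha\}$ be a crossed system with category crossed product $A \rtimes_{\alpha}^{\sigma} G$, and consider the following conditions: (0) all $\alpha(s,t)$, $(s,t) \in G^{(2)}$, are nonzero; (i) $A \rtimes_{\alpha}^{\sigma} G$ is commutative; (ii) $G$ is the disjoint union of the monoids $G_e$, $e \in ob(G)$ (i.e. $d(s)=c(s)$ for every $s\in G$), and they are all abelian; (iii) each $A_e \rtimes_{\alpha_e}^{\sigma_e} G_e$, $e \in ob(G)$, is a twisted monoid algebra; (iv) $A$ is commutative; (v) $\alpha$ is symmetric. Then: (a) conditions (0) and (i) imply conditions (ii), (iii), (iv) and (v); (b) conditions (ii), (iii), (iv) and (v) together imply condition (i).
   Context: Rings are associative and unital; ring homomorphisms preserve multiplicative identities. $G$ is a small category; an object is identified with its identity morphism; $s \in G$ means that $s$ is a morphism of $G$; $d(s)$ and $c(s)$ are the domain and codomain of $s$; $G^{(2)}$ is the set of pairs $(s,t)$ of morphisms with $d(s)=c(t)$ (so that $st$ is defined), and $G^{(3)}$ is the set of triples $(s,t,r)$ with $(s,t),(t,r)\in G^{(2)}$. A crossed system is a quadruple $\{A,G,\sigma,\alpha\}$ where $A$ is the direct sum of rings $A_e$, $e\in ob(G)$; $\sigma_s : A_{d(s)}\to A_{c(s)}$, $s\in G$, are ring homomorphisms; and $\alpha$ assigns to each $(s,t)\in G^{(2)}$ an element $\alpha(s,t)\in A_{c(s)}$, such that for all $e\in ob(G)$, all $(s,t,r)\in G^{(3)}$ and all $a\in A_{d(t)}$: $\sigma_e=\mathrm{id}_{A_e}$;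 $\alpha(s,d(s))=1_{A_{c(s)}}$; $\alpha(c(t),t)=1_{A_{c(t)}}$; $\alpha(s,t)\alpha(st,r)=\sigma_s(\alpha(t,r))\alpha(s,tr)$; $\sigma_s(\sigma_t(a))\alpha(s,t)=\alpha(s,t)\sigma_{st}(a)$. The category crossed product $A\rtimes_\alpha^\sigma G$ is the set of formal sums $\sum_{s\in G}a_su_s$ with $a_s\in A_{c(s)}$, all but finitely many zero, with componentwise addition and multiplication given by biadditive extension of $(a_su_s)(b_tu_t)=a_s\sigma_s(b_t)\alpha(s,t)u_{st}$ if $(s,t)\in G^{(2)}$ and $(a_su_s)(b_tu_t)=0$ otherwise. It is associative but need not have a multiplicative identity when $ob(G)$ is infinite. For $e\in ob(G)$, $G_e$ is the monoid of all $s\in G$ with $d(s)=c(s)=e$, and $A_e \rtimes_{\alpha_e}^{\sigma_e} G_e$ is the crossed product obtained by restricting $\alpha$ to $G_e\times G_e$ and $\sigma$ to $G_e$. It is a twisted monoid algebra if $\sigma_s=\mathrm{id}_{A_e}$ for all $s\in G_e$. The map $\alpha$ is symmetric if $\alpha(s,t)=\alpha(t,s)$ for all $s,t\in G$ with $d(s)=c(s)=d(t)=c(t)$. *)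

theory Defs
  imports "HOL-Algebra.Ring" "HOL-Library.Disjoint_Sets"
begin

section \<open>Small categories\<close>

text \<open>
  Categories are arrows-only: an object is identified with its identity morphism.  As in
  composition of functions, \<open>s \<cdot> t\<close> is meaningful when \<open>src s = trg t\<close>.
\<close>

record 'g cat =
  arr :: "'g set"
  src :: "'g \<Rightarrow> 'g"  (\<open>src\<index>\<close>)
  trg :: "'g \<Rightarrow> 'g"  (\<open>trg\<index>\<close>)
  cmp :: "'g \<Rightarrow> 'g \<Rightarrow> 'g"  (infixl \<open>\<cdot>\<index>\<close> 70)

locale small_category =
  fixes G :: "('g, 'k) cat_scheme" (structure)
  assumes src_arr: "s \<in> arr G \<Longrightarrow> src s \<in> arr G"
    and trg_arr: "s \<in> arr G \<Longrightarrow> trg s \<in> arr G"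
    and src_src: "s \<in> arr G \<Longrightarrow> src (src s) = src s"
    and trg_src: "s \<in> arr G \<Longrightarrow> trg (src s) = src s"
    and src_trg: "s \<in> arr G \<Longrightarrow> src (trg s) = trg s"
    and trg_trg: "s \<in> arr G \<Longrightarrow> trg (trg s) = trg s"
    and cmp_arr: "\<lbrakk>s \<in> arr G; t \<in> arr G; src s = trg t\<rbrakk> \<Longrightarrow> s \<cdot> t \<in> arr G"
    and src_cmp: "\<lbrakk>s \<in> arr G; t \<in> arr G; src s = trg t\<rbrakk> \<Longrightarrow> src (s \<cdot> t) = src t"
    and trg_cmp: "\<lbrakk>s \<in> arr G; t \<in> arr G; src s = trg t\<rbrakk> \<Longrightarrow> trg (s \<cdot> t) = trg s"
    and cmp_src: "s \<in> arr G \<Longrightarrow> s \<cdot> src s = s"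
    and trg_cmp_self: "s \<in> arr G \<Longrightarrow> trg s \<cdot> s = s"
    and cmp_assoc: "\<lbrakk>s \<in> arr G; t \<in> arr G; r \<in> arr G; src s = trg t; src t = trg r\<rbrakk>
        \<Longrightarrow> (s \<cdot> t) \<cdot> r = s \<cdot> (t \<cdot> r)"

definition ob :: "('g, 'k) cat_scheme \<Rightarrow> 'g set" where
  "ob G = {e \<in> arr G. src\<^bsub>G\<^esub> e = e}"

definition composable :: "('g, 'k) cat_scheme \<Rightarrow> ('g \<times> 'g) set" where
  "composable G = {(s, t). s \<in> arr G \<and> t \<in> arr G \<and> src\<^bsub>G\<^esub> s = trg\<^bsub>G\<^esub> t}"

definition vertex_monoid :: "('g, 'k) cat_scheme \<Rightarrow> 'g \<Rightarrow> 'g monoid" where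
  "vertex_monoid G e =
    \<lparr>carrier = {s \<in> arr G. src\<^bsub>G\<^esub> s = e \<and> trg\<^bsub>G\<^esub> s = e}, mult = cmp G, one = e\<rparr>"

text \<open>The same monoid, viewed as the full subcategory of \<open>G\<close> with the single object \<open>e\<close>.\<close>

definition vertex_category :: "('g, 'k) cat_scheme \<Rightarrow> 'g \<Rightarrow> ('g, 'k) cat_scheme" where
  "vertex_category G e = G\<lparr>arr := carrier (vertex_monoid G e)\<rparr>"

definition disjoint_union_of_vertex_monoids :: "('g, 'k) cat_scheme \<Rightarrow> bool" where
  "disjoint_union_of_vertex_monoids G \<longleftrightarrow>
    arr G = (\<Union>e \<in> ob G. carrier (vertex_monoid G e)) \<and>
    disjoint_family_on (\<lambda>e. carrier (vertex_monoid G e)) (ob G)"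

context small_category
begin

lemma obI_src: "s \<in> arr G \<Longrightarrow> src s \<in> ob G"
  by (simp add: ob_def src_arr src_src)

lemma obI_trg: "s \<in> arr G \<Longrightarrow> trg s \<in> ob G"
  by (simp add: ob_def trg_arr src_trg)

lemma ob_arr: "e \<in> ob G \<Longrightarrow> e \<in> arr G"
  by (simp add: ob_def)

lemma ob_src: "e \<in> ob G \<Longrightarrow> src e = e"
  by (simp add: ob_def)

lemma ob_trg: "e \<in> ob G \<Longrightarrow> trg e = e"
  using trg_src[of e] by (simp add: ob_def)

lemma vertex_monoid_is_monoid:
  assumes "e \<in> ob G"
  shows "monoid (vertex_monoid G e)"
  by (rule monoidI)
     (use assms ob_arr ob_src ob_trg cmp_assoc cmp_src trg_cmp_self in
       \<open>force simp: vertex_monoid_def cmp_arr src_cmp trg_cmp\<close>)+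

lemma disjoint_union_of_vertex_monoids_iff:
  "disjoint_union_of_vertex_monoids G \<longleftrightarrow> (\<forall>s \<in> arr G. src s = trg s)"
proof
  assume "disjoint_union_of_vertex_monoids G"
  then have U: "arr G = (\<Union>e \<in> ob G. carrier (vertex_monoid G e))"
    by (simp add: disjoint_union_of_vertex_monoids_def)
  show "\<forall>s \<in> arr G. src s = trg s"
  proof
    fix s assume "s \<in> arr G"
    then have "s \<in> (\<Union>e \<in> ob G. carrier (vertex_monoid G e))" using U by (rule subst[rotated])
    then show "src s = trg s" by (auto simp: vertex_monoid_def)
  qed
qed (auto simp: disjoint_union_of_vertex_monoids_def vertex_monoid_def disjoint_family_on_def obI_trg)

end


section \<open>Direct sums of rings\<close>

text \<open>
  With infinitely many nonzero summands the direct sum has no multiplicative identity.  The field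
  \<open>one\<close> of the record then holds the formal identity, which lies outside the carrier; likewise for
  the crossed product below.  Hence commutativity is stated for the multiplication alone and not
  through \<^locale>\<open>cring\<close>.
\<close>

definition direct_sum :: "'i set \<Rightarrow> ('i \<Rightarrow> ('a, 'm) ring_scheme) \<Rightarrow> ('i \<Rightarrow> 'a) ring" where
  "direct_sum I A =
    \<lparr>carrier = {x \<in> \<Pi>\<^sub>E i\<in>I. carrier (A i). finite {i \<in> I. x i \<noteq> \<zero>\<^bsub>A i\<^esub>}},
     mult = \<lambda>x y. \<lambda>i\<in>I. x i \<otimes>\<^bsub>A i\<^esub> y i,
     one = \<lambda>i\<in>I. \<one>\<^bsub>A i\<^esub>,
     zero = \<lambda>i\<in>I. \<zero>\<^bsub>A i\<^esub>,
     add = \<lambda>x y. \<lambda>i\<in>I. x i \<oplus>\<^bsub>A i\<^esub> y i\<rparr>"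

definition commutative :: "('a, 'm) monoid_scheme \<Rightarrow> bool" where
  "commutative R \<longleftrightarrow> (\<forall>x \<in> carrier R. \<forall>y \<in> carrier R. x \<otimes>\<^bsub>R\<^esub> y = y \<otimes>\<^bsub>R\<^esub> x)"


section \<open>Crossed systems and category crossed products\<close>

text \<open>
  The rings \<open>A e\<close> share one carrier type, which is no restriction for a set-indexed family.  Only
  the values of \<open>A\<close> on objects, of \<open>\<sigma>\<close> on morphisms (and there on the carrier of the domain) and of
  \<open>\<alpha>\<close> on composable pairs matter.
\<close>

locale crossed_system = small_category G
  for G :: "('g, 'k) cat_scheme" (structure) +
  fixes A :: "'g \<Rightarrow> ('a, 'm) ring_scheme"
    and \<sigma> :: "'g \<Rightarrow> 'a \<Rightarrow> 'a"
    and \<alpha> :: "'g \<Rightarrow> 'g \<Rightarrow> 'a"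
  assumes ring_A: "e \<in> ob G \<Longrightarrow> ring (A e)"
    and \<sigma>_hom: "s \<in> arr G \<Longrightarrow> \<sigma> s \<in> ring_hom (A (src s)) (A (trg s))"
    and \<alpha>_closed: "(s, t) \<in> composable G \<Longrightarrow> \<alpha> s t \<in> carrier (A (trg s))"
    and \<sigma>_ob: "\<lbrakk>e \<in> ob G; a \<in> carrier (A e)\<rbrakk> \<Longrightarrow> \<sigma> e a = a"
    and \<alpha>_src: "s \<in> arr G \<Longrightarrow> \<alpha> s (src s) = \<one>\<^bsub>A (trg s)\<^esub>"
    and \<alpha>_trg: "t \<in> arr G \<Longrightarrow> \<alpha> (trg t) t = \<one>\<^bsub>A (trg t)\<^esub>"
    and \<alpha>_cocycle: "\<lbrakk>(s, t) \<in> composable G; (t, r) \<in> composable G\<rbrakk> \<Longrightarrow>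
        \<alpha> s t \<otimes>\<^bsub>A (trg s)\<^esub> \<alpha> (s \<cdot> t) r = \<sigma> s (\<alpha> t r) \<otimes>\<^bsub>A (trg s)\<^esub> \<alpha> s (t \<cdot> r)"
    and \<sigma>_\<alpha>: "\<lbrakk>(s, t) \<in> composable G; a \<in> carrier (A (src t))\<rbrakk> \<Longrightarrow>
        \<sigma> s (\<sigma> t a) \<otimes>\<^bsub>A (trg s)\<^esub> \<alpha> s t = \<alpha> s t \<otimes>\<^bsub>A (trg s)\<^esub> \<sigma> (s \<cdot> t) a"

text \<open>
  A formal sum \<open>\<Sum>s. a\<^sub>s u\<^sub>s\<close> is represented by its coefficient function.  The lemmas below confirm
  that the multiplication is biadditive with the intended values on the monomials \<open>a u\<^sub>s\<close>.
\<close>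

definition crossed_product ::
  "('g, 'k) cat_scheme \<Rightarrow> ('g \<Rightarrow> ('a, 'm) ring_scheme) \<Rightarrow> ('g \<Rightarrow> 'a \<Rightarrow> 'a) \<Rightarrow>
   ('g \<Rightarrow> 'g \<Rightarrow> 'a) \<Rightarrow> ('g \<Rightarrow> 'a) ring" where
  "crossed_product G A \<sigma> \<alpha> =
    \<lparr>carrier = {x \<in> \<Pi>\<^sub>E s\<in>arr G. carrier (A (trg\<^bsub>G\<^esub> s)).
        finite {s \<in> arr G. x s \<noteq> \<zero>\<^bsub>A (trg\<^bsub>G\<^esub> s)\<^esub>}},
     mult = \<lambda>x y. \<lambda>r\<in>arr G.
        \<Oplus>\<^bsub>A (trg\<^bsub>G\<^esub> r)\<^esub> p \<in> {(s, t) \<in> composable G. s \<cdot>\<^bsub>G\<^esub> t = r \<and>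
            x s \<noteq> \<zero>\<^bsub>A (trg\<^bsub>G\<^esub> s)\<^esub> \<and> y t \<noteq> \<zero>\<^bsub>A (trg\<^bsub>G\<^esub> t)\<^esub>}.
          x (fst p) \<otimes>\<^bsub>A (trg\<^bsub>G\<^esub> r)\<^esub> \<sigma> (fst p) (y (snd p)) \<otimes>\<^bsub>A (trg\<^bsub>G\<^esub> r)\<^esub> \<alpha> (fst p) (snd p),
     one = \<lambda>s\<in>arr G. if s \<in> ob G then \<one>\<^bsub>A s\<^esub> else \<zero>\<^bsub>A (trg\<^bsub>G\<^esub> s)\<^esub>,
     zero = \<lambda>s\<in>arr G. \<zero>\<^bsub>A (trg\<^bsub>G\<^esub> s)\<^esub>,
     add = \<lambda>x y. \<lambda>s\<in>arr G. x s \<oplus>\<^bsub>A (trg\<^bsub>G\<^esub> s)\<^esub> y s\<rparr>"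

definition monomial ::
  "('g, 'k) cat_scheme \<Rightarrow> ('g \<Rightarrow> ('a, 'm) ring_scheme) \<Rightarrow> 'a \<Rightarrow> 'g \<Rightarrow> 'g \<Rightarrow> 'a" where
  "monomial G A a s = (\<lambda>r\<in>arr G. if r = s then a else \<zero>\<^bsub>A (trg\<^bsub>G\<^esub> r)\<^esub>)"

text \<open>
  The crossed product of a crossed system over a monoid (a category with one object) is a twisted
  monoid algebra when \<open>\<sigma>\<close> is trivial.
\<close>

definition twisted_monoid_algebra ::
  "('g, 'k) cat_scheme \<Rightarrow> ('g \<Rightarrow> ('a, 'm) ring_scheme) \<Rightarrow> ('g \<Rightarrow> 'a \<Rightarrow> 'a) \<Rightarrow>
   ('g \<Rightarrow> 'g \<Rightarrow> 'a) \<Rightarrow> bool" where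
  "twisted_monoid_algebra G A \<sigma> \<alpha> \<longleftrightarrow>
    crossed_system G A \<sigma> \<alpha> \<and> is_singleton (ob G) \<and>
    (\<forall>s \<in> arr G. \<forall>a \<in> carrier (A (src\<^bsub>G\<^esub> s)). \<sigma> s a = a)"

definition symmetric_twist :: "('g, 'k) cat_scheme \<Rightarrow> ('g \<Rightarrow> 'g \<Rightarrow> 'a) \<Rightarrow> bool" where
  "symmetric_twist G \<alpha> \<longleftrightarrow>
    (\<forall>e \<in> ob G. \<forall>s \<in> carrier (vertex_monoid G e). \<forall>t \<in> carrier (vertex_monoid G e). \<alpha> s t = \<alpha> t s)"

context crossed_system
begin

abbreviation CP where "CP \<equiv> crossed_product G A \<sigma> \<alpha>"

lemma ring_trg: "s \<in> arr G \<Longrightarrow> ring (A (trg s))"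
  by (simp add: obI_trg ring_A)

lemma ring_src: "s \<in> arr G \<Longrightarrow> ring (A (src s))"
  by (simp add: obI_src ring_A)

lemma \<sigma>_zero: "s \<in> arr G \<Longrightarrow> \<sigma> s \<zero>\<^bsub>A (src s)\<^esub> = \<zero>\<^bsub>A (trg s)\<^esub>"
  by (rule ring_hom_zero[OF \<sigma>_hom ring_src ring_trg])

lemma coeff_closed: "\<lbrakk>x \<in> carrier CP; s \<in> arr G\<rbrakk> \<Longrightarrow> x s \<in> carrier (A (trg s))"
  by (auto simp: crossed_product_def)

lemma term_closed:
  assumes "a \<in> carrier (A (trg s))" "b \<in> carrier (A (trg t))" "(s, t) \<in> composable G"
  shows "a \<otimes>\<^bsub>A (trg s)\<^esub> \<sigma> s b \<otimes>\<^bsub>A (trg s)\<^esub> \<alpha> s t \<in> carrier (A (trg s))"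
proof -
  have s: "s \<in> arr G" and st: "src s = trg t"
    using assms(3) by (auto simp: composable_def)
  interpret R: ring "A (trg s)" by (rule ring_trg[OF s])
  show ?thesis
    using assms \<alpha>_closed[OF assms(3)] ring_hom_closed[OF \<sigma>_hom[OF s]] st by simp
qed

lemma mult_eq_finsum:
  assumes x: "x \<in> carrier CP" and y: "y \<in> carrier CP" and r: "r \<in> arr G"
    and fin: "finite S" "finite T"
    and S: "{s \<in> arr G. x s \<noteq> \<zero>\<^bsub>A (trg s)\<^esub>} \<subseteq> S"
    and T: "{t \<in> arr G. y t \<noteq> \<zero>\<^bsub>A (trg t)\<^esub>} \<subseteq> T"
  shows "(x \<otimes>\<^bsub>CP\<^esub> y) r =
    (\<Oplus>\<^bsub>A (trg r)\<^esub> p \<in> {(s, t) \<in> composable G. s \<cdot> t = r \<and> s \<in> S \<and> t \<in> T}.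
      x (fst p) \<otimes>\<^bsub>A (trg r)\<^esub> \<sigma> (fst p) (y (snd p)) \<otimes>\<^bsub>A (trg r)\<^esub> \<alpha> (fst p) (snd p))"
    (is "_ = finsum _ ?f ?P")
proof -
  interpret R: ring "A (trg r)" by (rule ring_trg[OF r])
  have D: "s \<in> arr G \<and> t \<in> arr G \<and> src s = trg t \<and> trg r = trg s"
    if "(s, t) \<in> composable G" "s \<cdot> t = r" for s t
    using that trg_cmp by (auto simp: composable_def)
  have closed: "?f p \<in> carrier (A (trg r))" if "p \<in> ?P" for p
  proof -
    obtain s t where p: "p = (s, t)" by (cases p)
    with that have c: "(s, t) \<in> composable G" "s \<cdot> t = r" by auto
    show ?thesis
      using term_closed[OF coeff_closed[OF x] coeff_closed[OF y] c(1)] D[OF c] by (simp add: p)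
  qed
  have vanish: "?f p = \<zero>\<^bsub>A (trg r)\<^esub>"
    if "p \<in> ?P - {(s, t) \<in> composable G. s \<cdot> t = r \<and>
            x s \<noteq> \<zero>\<^bsub>A (trg s)\<^esub> \<and> y t \<noteq> \<zero>\<^bsub>A (trg t)\<^esub>}" for p
  proof -
    obtain s t where p: "p = (s, t)" by (cases p)
    with that have c: "(s, t) \<in> composable G" "s \<cdot> t = r"
      and z: "x s = \<zero>\<^bsub>A (trg s)\<^esub> \<or> y t = \<zero>\<^bsub>A (trg t)\<^esub>" by auto
    note d = D[OF c]
    have cl: "x s \<in> carrier (A (trg r))" "\<sigma> s (y t) \<in> carrier (A (trg r))"
      "\<alpha> s t \<in> carrier (A (trg r))"
      using coeff_closed[OF x, of s] coeff_closed[OF y, of t] ring_hom_closed[OF \<sigma>_hom, of s "y t"]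
        \<alpha>_closed[OF c(1)] d by auto
    from z show ?thesis
    proof
      assume "x s = \<zero>\<^bsub>A (trg s)\<^esub>"
      then have "x s = \<zero>\<^bsub>A (trg r)\<^esub>" using d by simp
      then show ?thesis using cl by (simp add: p)
    next
      assume "y t = \<zero>\<^bsub>A (trg t)\<^esub>"
      then have "\<sigma> s (y t) = \<zero>\<^bsub>A (trg r)\<^esub>" using \<sigma>_zero[of s] d by simp
      then show ?thesis using cl by (simp add: p)
    qed
  qed
  have "?P \<subseteq> S \<times> T" by auto
  then have finP: "finite ?P" using fin finite_subset by blast
  have sub: "{(s, t) \<in> composable G. s \<cdot> t = r \<and>
            x s \<noteq> \<zero>\<^bsub>A (trg s)\<^esub> \<and> y t \<noteq> \<zero>\<^bsub>A (trg t)\<^esub>} \<subseteq> ?P"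
    using S T by (auto simp: composable_def)
  have "finsum (A (trg r)) ?f {(s, t) \<in> composable G. s \<cdot> t = r \<and>
            x s \<noteq> \<zero>\<^bsub>A (trg s)\<^esub> \<and> y t \<noteq> \<zero>\<^bsub>A (trg t)\<^esub>} = finsum (A (trg r)) ?f ?P"
    by (rule R.add.finprod_mono_neutral_cong_left[OF finP sub vanish])
       (use closed in auto)
  then show ?thesis
    using r by (simp add: crossed_product_def)
qed

lemma finite_supp: "x \<in> carrier CP \<Longrightarrow> finite {s \<in> arr G. x s \<noteq> \<zero>\<^bsub>A (trg s)\<^esub>}"
  by (simp add: crossed_product_def)

lemma add_coeff: "s \<in> arr G \<Longrightarrow> (x \<oplus>\<^bsub>CP\<^esub> y) s = x s \<oplus>\<^bsub>A (trg s)\<^esub> y s"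
  by (simp add: crossed_product_def)

lemma add_closed:
  assumes "x \<in> carrier CP" "y \<in> carrier CP"
  shows "x \<oplus>\<^bsub>CP\<^esub> y \<in> carrier CP"
proof -
  have "{s \<in> arr G. (x \<oplus>\<^bsub>CP\<^esub> y) s \<noteq> \<zero>\<^bsub>A (trg s)\<^esub>} \<subseteq>
      {s \<in> arr G. x s \<noteq> \<zero>\<^bsub>A (trg s)\<^esub>} \<union> {s \<in> arr G. y s \<noteq> \<zero>\<^bsub>A (trg s)\<^esub>}"
    using abelian_monoid.l_zero[OF abelian_group.axioms(1)[OF ring.is_abelian_group[OF ring_trg]]]
      abelian_monoid.zero_closed[OF abelian_group.axioms(1)[OF ring.is_abelian_group[OF ring_trg]]]
    by (auto simp: add_coeff)
  then have "finite {s \<in> arr G. (x \<oplus>\<^bsub>CP\<^esub> y) s \<noteq> \<zero>\<^bsub>A (trg s)\<^esub>}"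
    using assms[THEN finite_supp] finite_subset by blast
  moreover have "(x \<oplus>\<^bsub>CP\<^esub> y) s \<in> carrier (A (trg s))" if "s \<in> arr G" for s
    using that assms[THEN coeff_closed]
      abelian_monoid.a_closed[OF abelian_group.axioms(1)[OF ring.is_abelian_group[OF ring_trg]]]
    by (simp add: add_coeff)
  ultimately show ?thesis by (simp add: crossed_product_def)
qed

lemma mult_closed:
  assumes x: "x \<in> carrier CP" and y: "y \<in> carrier CP"
  shows "x \<otimes>\<^bsub>CP\<^esub> y \<in> carrier CP"
proof -
  let ?S = "{s \<in> arr G. x s \<noteq> \<zero>\<^bsub>A (trg s)\<^esub>}" and ?T = "{t \<in> arr G. y t \<noteq> \<zero>\<^bsub>A (trg t)\<^esub>}"
  note eq = mult_eq_finsum[OF x y _ finite_supp[OF x] finite_supp[OF y] subset_refl subset_refl]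
  have "{r \<in> arr G. (x \<otimes>\<^bsub>CP\<^esub> y) r \<noteq> \<zero>\<^bsub>A (trg r)\<^esub>} \<subseteq> (\<lambda>(s, t). s \<cdot> t) ` (?S \<times> ?T)"
  proof clarify
    fix r assume r: "r \<in> arr G" and nz: "(x \<otimes>\<^bsub>CP\<^esub> y) r \<noteq> \<zero>\<^bsub>A (trg r)\<^esub>"
    interpret R: ring "A (trg r)" by (rule ring_trg[OF r])
    have "{(s, t) \<in> composable G. s \<cdot> t = r \<and> s \<in> ?S \<and> t \<in> ?T} \<noteq> {}"
      (is "?P \<noteq> _")
    proof
      assume "?P = {}"
      with nz show False unfolding eq[OF r] by (metis (no_types, lifting) R.finsum_empty)
    qed
    then show "r \<in> (\<lambda>(s, t). s \<cdot> t) ` (?S \<times> ?T)" by auto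
  qed
  then have "finite {r \<in> arr G. (x \<otimes>\<^bsub>CP\<^esub> y) r \<noteq> \<zero>\<^bsub>A (trg r)\<^esub>}"
    by (rule finite_subset) (use finite_supp x y in auto)
  moreover have "(x \<otimes>\<^bsub>CP\<^esub> y) r \<in> carrier (A (trg r))" if r: "r \<in> arr G" for r
  proof -
    interpret R: ring "A (trg r)" by (rule ring_trg[OF r])
    show ?thesis
      unfolding eq[OF r]
    proof (rule R.finsum_closed, rule Pi_I, clarify)
      fix s t assume st: "(s, t) \<in> composable G" and r': "r = s \<cdot> t"
      have "s \<in> arr G" "t \<in> arr G" "trg (s \<cdot> t) = trg s"
        using st trg_cmp by (auto simp: composable_def)
      then show "x (fst (s, t)) \<otimes>\<^bsub>A (trg (s \<cdot> t))\<^esub> \<sigma> (fst (s, t)) (y (snd (s, t)))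
          \<otimes>\<^bsub>A (trg (s \<cdot> t))\<^esub> \<alpha> (fst (s, t)) (snd (s, t)) \<in> carrier (A (trg (s \<cdot> t)))"
        using term_closed[OF coeff_closed[OF x] coeff_closed[OF y] st] by simp
    qed
  qed
  ultimately show ?thesis by (simp add: crossed_product_def)
qed

lemma mult_biadditive:
  assumes x: "x \<in> carrier CP" and x': "x' \<in> carrier CP"
    and y: "y \<in> carrier CP" and y': "y' \<in> carrier CP"
  shows "(x \<oplus>\<^bsub>CP\<^esub> x') \<otimes>\<^bsub>CP\<^esub> y = (x \<otimes>\<^bsub>CP\<^esub> y) \<oplus>\<^bsub>CP\<^esub> (x' \<otimes>\<^bsub>CP\<^esub> y)"
    and "x \<otimes>\<^bsub>CP\<^esub> (y \<oplus>\<^bsub>CP\<^esub> y') = (x \<otimes>\<^bsub>CP\<^esub> y) \<oplus>\<^bsub>CP\<^esub> (x \<otimes>\<^bsub>CP\<^esub> y')"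
proof -
  define S where "S = {s \<in> arr G. x s \<noteq> \<zero>\<^bsub>A (trg s)\<^esub>} \<union> {s \<in> arr G. x' s \<noteq> \<zero>\<^bsub>A (trg s)\<^esub>}
      \<union> {s \<in> arr G. (x \<oplus>\<^bsub>CP\<^esub> x') s \<noteq> \<zero>\<^bsub>A (trg s)\<^esub>}"
  define T where "T = {s \<in> arr G. y s \<noteq> \<zero>\<^bsub>A (trg s)\<^esub>} \<union> {s \<in> arr G. y' s \<noteq> \<zero>\<^bsub>A (trg s)\<^esub>}
      \<union> {s \<in> arr G. (y \<oplus>\<^bsub>CP\<^esub> y') s \<noteq> \<zero>\<^bsub>A (trg s)\<^esub>}"
  have fin: "finite S" "finite T"
    unfolding S_def T_def using assms finite_supp add_closed by simp_all
  note eq = mult_eq_finsum[OF _ _ _ fin]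
  have "((x \<oplus>\<^bsub>CP\<^esub> x') \<otimes>\<^bsub>CP\<^esub> y) r = ((x \<otimes>\<^bsub>CP\<^esub> y) \<oplus>\<^bsub>CP\<^esub> (x' \<otimes>\<^bsub>CP\<^esub> y)) r \<and>
     (x \<otimes>\<^bsub>CP\<^esub> (y \<oplus>\<^bsub>CP\<^esub> y')) r = ((x \<otimes>\<^bsub>CP\<^esub> y) \<oplus>\<^bsub>CP\<^esub> (x \<otimes>\<^bsub>CP\<^esub> y')) r" if r: "r \<in> arr G" for r
  proof -
    interpret R: ring "A (trg r)" by (rule ring_trg[OF r])
    let ?P = "{(s, t) \<in> composable G. s \<cdot> t = r \<and> s \<in> S \<and> t \<in> T}"
    let ?f = "\<lambda>x y p. x (fst p) \<otimes>\<^bsub>A (trg r)\<^esub> \<sigma> (fst p) (y (snd p)) \<otimes>\<^bsub>A (trg r)\<^esub> \<alpha> (fst p) (snd p)"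
    have P: "fst p \<in> arr G \<and> snd p \<in> arr G \<and> src (fst p) = trg (snd p) \<and> trg (fst p) = trg r
        \<and> \<alpha> (fst p) (snd p) \<in> carrier (A (trg r))
        \<and> \<sigma> (fst p) \<in> ring_hom (A (trg (snd p))) (A (trg r))"
      if "p \<in> ?P" for p
    proof -
      obtain s t where p: "p = (s, t)" by (cases p)
      with that show ?thesis
        using \<alpha>_closed[of s t] \<sigma>_hom[of s] trg_cmp[of s t] by (auto simp: composable_def)
    qed
    have cl: "z (fst p) \<in> carrier (A (trg r))" "\<sigma> (fst p) (z (snd p)) \<in> carrier (A (trg r))"
      "z (snd p) \<in> carrier (A (trg (snd p)))"
      if "p \<in> ?P" "z \<in> carrier CP" for p z
      using P[OF that(1)] coeff_closed[OF that(2)] ring_hom_closed by metis+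
    have Pi: "?f u v \<in> ?P \<rightarrow> carrier (A (trg r))" if "u \<in> carrier CP" "v \<in> carrier CP" for u v
    proof
      fix p assume p: "p \<in> ?P"
      show "?f u v p \<in> carrier (A (trg r))"
        using cl(1)[OF p that(1)] cl(2)[OF p that(2)] P[OF p] by simp
    qed
    have "((x \<oplus>\<^bsub>CP\<^esub> x') \<otimes>\<^bsub>CP\<^esub> y) r = finsum (A (trg r)) (?f (x \<oplus>\<^bsub>CP\<^esub> x') y) ?P"
      by (rule eq[OF add_closed[OF x x'] y r]) (auto simp: S_def T_def)
    also have "\<dots> = finsum (A (trg r)) (\<lambda>p. ?f x y p \<oplus>\<^bsub>A (trg r)\<^esub> ?f x' y p) ?P"
    proof (rule R.finsum_cong')
      fix p assume p: "p \<in> ?P"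
      show "?f (x \<oplus>\<^bsub>CP\<^esub> x') y p = ?f x y p \<oplus>\<^bsub>A (trg r)\<^esub> ?f x' y p"
        using cl(1)[OF p x] cl(1)[OF p x'] cl(2)[OF p y] P[OF p]
        by (simp add: add_coeff R.l_distr)
    next
      show "(\<lambda>p. ?f x y p \<oplus>\<^bsub>A (trg r)\<^esub> ?f x' y p) \<in> ?P \<rightarrow> carrier (A (trg r))"
        by (rule Pi_I, rule R.a_closed)
           (erule funcset_mem[OF Pi[OF x y]], erule funcset_mem[OF Pi[OF x' y]])
    qed simp
    also have "\<dots> = finsum (A (trg r)) (?f x y) ?P \<oplus>\<^bsub>A (trg r)\<^esub> finsum (A (trg r)) (?f x' y) ?P"
      by (rule R.finsum_addf) (use Pi x x' y in auto)
    also have "finsum (A (trg r)) (?f x y) ?P = (x \<otimes>\<^bsub>CP\<^esub> y) r"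
      by (rule eq[OF x y r, symmetric]) (auto simp: S_def T_def)
    also have "finsum (A (trg r)) (?f x' y) ?P = (x' \<otimes>\<^bsub>CP\<^esub> y) r"
      by (rule eq[OF x' y r, symmetric]) (auto simp: S_def T_def)
    finally have 1: "((x \<oplus>\<^bsub>CP\<^esub> x') \<otimes>\<^bsub>CP\<^esub> y) r = ((x \<otimes>\<^bsub>CP\<^esub> y) \<oplus>\<^bsub>CP\<^esub> (x' \<otimes>\<^bsub>CP\<^esub> y)) r"
      using r by (simp add: add_coeff)
    have "(x \<otimes>\<^bsub>CP\<^esub> (y \<oplus>\<^bsub>CP\<^esub> y')) r = finsum (A (trg r)) (?f x (y \<oplus>\<^bsub>CP\<^esub> y')) ?P"
      by (rule eq[OF x add_closed[OF y y'] r]) (auto simp: S_def T_def)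
    also have "\<dots> = finsum (A (trg r)) (\<lambda>p. ?f x y p \<oplus>\<^bsub>A (trg r)\<^esub> ?f x y' p) ?P"
    proof (rule R.finsum_cong')
      fix p assume p: "p \<in> ?P"
      have "\<sigma> (fst p) ((y \<oplus>\<^bsub>CP\<^esub> y') (snd p)) =
          \<sigma> (fst p) (y (snd p)) \<oplus>\<^bsub>A (trg r)\<^esub> \<sigma> (fst p) (y' (snd p))"
        using ring_hom_add[of "\<sigma> (fst p)" "A (trg (snd p))" "A (trg r)" "y (snd p)" "y' (snd p)"]
          P[OF p] cl(3)[OF p y] cl(3)[OF p y']
        by (simp add: add_coeff)
      then show "?f x (y \<oplus>\<^bsub>CP\<^esub> y') p = ?f x y p \<oplus>\<^bsub>A (trg r)\<^esub> ?f x y' p"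
        using cl(1)[OF p x] cl(2)[OF p y] cl(2)[OF p y'] P[OF p]
        by (simp add: R.l_distr R.r_distr)
    next
      show "(\<lambda>p. ?f x y p \<oplus>\<^bsub>A (trg r)\<^esub> ?f x y' p) \<in> ?P \<rightarrow> carrier (A (trg r))"
        by (rule Pi_I, rule R.a_closed)
           (erule funcset_mem[OF Pi[OF x y]], erule funcset_mem[OF Pi[OF x y']])
    qed simp
    also have "\<dots> = finsum (A (trg r)) (?f x y) ?P \<oplus>\<^bsub>A (trg r)\<^esub> finsum (A (trg r)) (?f x y') ?P"
      by (rule R.finsum_addf) (use Pi x y y' in auto)
    also have "finsum (A (trg r)) (?f x y) ?P = (x \<otimes>\<^bsub>CP\<^esub> y) r"
      by (rule eq[OF x y r, symmetric]) (auto simp: S_def T_def)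
    also have "finsum (A (trg r)) (?f x y') ?P = (x \<otimes>\<^bsub>CP\<^esub> y') r"
      by (rule eq[OF x y' r, symmetric]) (auto simp: S_def T_def)
    finally have 2: "(x \<otimes>\<^bsub>CP\<^esub> (y \<oplus>\<^bsub>CP\<^esub> y')) r = ((x \<otimes>\<^bsub>CP\<^esub> y) \<oplus>\<^bsub>CP\<^esub> (x \<otimes>\<^bsub>CP\<^esub> y')) r"
      using r by (simp add: add_coeff)
    from 1 2 show ?thesis ..
  qed
  note eq_arr = this
  have ext_CP: "u = v"
    if "u \<in> carrier CP" "v \<in> carrier CP" "\<And>r. r \<in> arr G \<Longrightarrow> u r = v r" for u v
    by (rule extensionalityI[of _ "arr G"]) (use that in \<open>auto simp: crossed_product_def PiE_def\<close>)
  show "(x \<oplus>\<^bsub>CP\<^esub> x') \<otimes>\<^bsub>CP\<^esub> y = (x \<otimes>\<^bsub>CP\<^esub> y) \<oplus>\<^bsub>CP\<^esub> (x' \<otimes>\<^bsub>CP\<^esub> y)"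
    by (rule ext_CP) (simp_all only: add_closed mult_closed assms eq_arr)
  show "x \<otimes>\<^bsub>CP\<^esub> (y \<oplus>\<^bsub>CP\<^esub> y') = (x \<otimes>\<^bsub>CP\<^esub> y) \<oplus>\<^bsub>CP\<^esub> (x \<otimes>\<^bsub>CP\<^esub> y')"
    by (rule ext_CP) (simp_all only: add_closed mult_closed assms eq_arr)
qed

lemma monomial_closed:
  assumes "s \<in> arr G" "a \<in> carrier (A (trg s))"
  shows "monomial G A a s \<in> carrier CP"
proof -
  have "{r \<in> arr G. monomial G A a s r \<noteq> \<zero>\<^bsub>A (trg r)\<^esub>} \<subseteq> {s}"
    by (auto simp: monomial_def)
  then have "finite {r \<in> arr G. monomial G A a s r \<noteq> \<zero>\<^bsub>A (trg r)\<^esub>}"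
    by (rule finite_subset) simp
  moreover have "\<zero>\<^bsub>A (trg r)\<^esub> \<in> carrier (A (trg r))" if "r \<in> arr G" for r
    using ring.ring_simprules(2)[OF ring_trg[OF that]] .
  ultimately show ?thesis
    using assms by (auto simp: crossed_product_def monomial_def)
qed

lemma monomial_mult:
  assumes s: "s \<in> arr G" and a: "a \<in> carrier (A (trg s))"
    and t: "t \<in> arr G" and b: "b \<in> carrier (A (trg t))"
  shows "monomial G A a s \<otimes>\<^bsub>CP\<^esub> monomial G A b t =
    (if src s = trg t
     then monomial G A (a \<otimes>\<^bsub>A (trg s)\<^esub> \<sigma> s b \<otimes>\<^bsub>A (trg s)\<^esub> \<alpha> s t) (s \<cdot> t)
     else \<zero>\<^bsub>CP\<^esub>)"
proof (rule ext)
  fix r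
  let ?x = "monomial G A a s" and ?y = "monomial G A b t"
  show "(?x \<otimes>\<^bsub>CP\<^esub> ?y) r = (if src s = trg t
     then monomial G A (a \<otimes>\<^bsub>A (trg s)\<^esub> \<sigma> s b \<otimes>\<^bsub>A (trg s)\<^esub> \<alpha> s t) (s \<cdot> t)
     else \<zero>\<^bsub>CP\<^esub>) r"
  proof (cases "r \<in> arr G")
    case False
    then show ?thesis by (simp add: crossed_product_def monomial_def)
  next
    case r: True
    interpret R: ring "A (trg r)" by (rule ring_trg[OF r])
    have eq: "(?x \<otimes>\<^bsub>CP\<^esub> ?y) r =
      (\<Oplus>\<^bsub>A (trg r)\<^esub> p \<in> {(s', t') \<in> composable G. s' \<cdot> t' = r \<and> s' \<in> {s} \<and> t' \<in> {t}}.
        ?x (fst p) \<otimes>\<^bsub>A (trg r)\<^esub> \<sigma> (fst p) (?y (snd p)) \<otimes>\<^bsub>A (trg r)\<^esub> \<alpha> (fst p) (snd p))"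
      by (rule mult_eq_finsum[OF monomial_closed[OF s a] monomial_closed[OF t b] r])
         (auto simp: monomial_def)
    show ?thesis
    proof (cases "src s = trg t \<and> s \<cdot> t = r")
      case True
      then have c: "(s, t) \<in> composable G" using s t by (simp add: composable_def)
      have tr: "trg r = trg s" using True trg_cmp[OF s t] by auto
      have P: "{(s', t') \<in> composable G. s' \<cdot> t' = r \<and> s' \<in> {s} \<and> t' \<in> {t}} = {(s, t)}"
        using True c by auto
      have "a \<otimes>\<^bsub>A (trg r)\<^esub> \<sigma> s b \<otimes>\<^bsub>A (trg r)\<^esub> \<alpha> s t \<in> carrier (A (trg r))"
        using term_closed[OF a b c] by (simp add: tr)
      moreover have "finsum (A (trg r)) f {(s, t)} = f (s, t)"
        if "f (s, t) \<in> carrier (A (trg r))" for f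
        using R.finsum_insert[of "{}" "(s, t)" f] that by simp
      ultimately show ?thesis
        unfolding eq P using True s t r tr by (simp add: monomial_def)
    next
      case False
      then have P: "{(s', t') \<in> composable G. s' \<cdot> t' = r \<and> s' \<in> {s} \<and> t' \<in> {t}} = {}"
        by (auto simp: composable_def)
      show ?thesis
        unfolding eq P using False r by (auto simp: monomial_def crossed_product_def)
    qed
  qed
qed

text \<open>Restriction to the monoid at \<open>e\<close> is again a crossed system, with the single object \<open>e\<close>.\<close>

lemma ob_vertex_category:
  assumes "e \<in> ob G"
  shows "ob (vertex_category G e) = {e}"
  using assms ob_trg[OF assms] by (auto simp: vertex_category_def vertex_monoid_def ob_def)

lemma crossed_system_vertex:
  assumes e: "e \<in> ob G"
  shows "crossed_system (vertex_category G e) A \<sigma> \<alpha>"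
proof -
  let ?H = "vertex_category G e"
  have H: "arr ?H = {s \<in> arr G. src s = e \<and> trg s = e}"
    "src\<^bsub>?H\<^esub> = src" "trg\<^bsub>?H\<^esub> = trg" "cmp ?H = cmp G"
    by (auto simp: vertex_category_def vertex_monoid_def fun_eq_iff)
  have c: "(s, t) \<in> composable ?H \<Longrightarrow> (s, t) \<in> composable G" for s t
    by (auto simp: composable_def H)
  have cat: "small_category ?H"
    using e ob_arr ob_src ob_trg
    by (intro small_category.intro, unfold H mem_Collect_eq)
       (simp_all add: cmp_arr src_cmp trg_cmp cmp_assoc, (metis cmp_src trg_cmp_self)+)
  have ring: "ring (A e')" if "e' \<in> ob ?H" for e'
    using that e ring_A ob_vertex_category by auto
  have id: "\<sigma> e' a = a" if "e' \<in> ob ?H" "a \<in> carrier (A e')" for e' a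
    using that e \<sigma>_ob ob_vertex_category by auto
  show ?thesis
    by (rule crossed_system.intro[OF cat], rule crossed_system_axioms.intro, unfold H)
       (fact ring, blast intro: \<sigma>_hom, blast intro: \<alpha>_closed c, fact id, blast intro: \<alpha>_src,
        blast intro: \<alpha>_trg, blast intro: \<alpha>_cocycle c, blast intro: \<sigma>_\<alpha> c)
qed

end

end

theory Submission
  imports Defs
begin

text \<open>
  Commutativity is tested on monomials.  For endomorphisms \<open>s, t\<close> of one object \<open>e\<close>,

    \<open>(a u\<^sub>s)(b u\<^sub>t) = a \<sigma>\<^sub>s(b) \<alpha>(s,t) u\<^sub>s\<^sub>t\<close>  and  \<open>(b u\<^sub>t)(a u\<^sub>s) = b \<sigma>\<^sub>t(a) \<alpha>(t,s) u\<^sub>t\<^sub>s\<close>.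

  Suppose that the crossed product is commutative.  Each of the other conditions comes from one
  choice of monomials in which nearly every factor on the right is an identity: \<open>u\<^sub>s\<close> against the
  unit at the source of \<open>s\<close> shows that \<open>s\<close> is an endomorphism, since otherwise one of the two
  products is \<open>u\<^sub>s\<close> and the other is not defined, hence zero; \<open>u\<^sub>s\<close> against \<open>b u\<^sub>e\<close> gives
  \<open>\<sigma>\<^sub>s(b) = b\<close>; \<open>a u\<^sub>e\<close> against \<open>b u\<^sub>e\<close> gives \<open>a b = b a\<close>; and \<open>u\<^sub>s\<close> against \<open>u\<^sub>t\<close> gives
  \<open>\<alpha>(s,t) u\<^sub>s\<^sub>t = \<alpha>(t,s) u\<^sub>t\<^sub>s\<close>, an equation that determines both the morphism and the coefficient
  because a monomial with nonzero coefficient has exactly one point of support.  Here the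
  values of \<open>\<alpha>\<close> have to be nonzero; by \<open>\<alpha>(s, src s) = 1\<close> this also makes every \<open>A\<^sub>e\<close> nontrivial, so
  that \<open>u\<^sub>s \<noteq> 0\<close> in the first test.

  Conversely, under the other conditions the two products above agree factor by factor, and pairs
  of morphisms at different objects contribute to neither product.  Hence the swap
  \<open>(s, t) \<mapsto> (t, s)\<close> matches the terms of \<open>x y\<close> with those of \<open>y x\<close>.
\<close>

section \<open>Commutative direct sums\<close>

lemma commutativeD:
  "\<lbrakk>commutative R; x \<in> carrier R; y \<in> carrier R\<rbrakk> \<Longrightarrow> x \<otimes>\<^bsub>R\<^esub> y = y \<otimes>\<^bsub>R\<^esub> x"
  by (simp add: commutative_def)

text \<open>
  Multiplication is componentwise, and every \<open>a \<in> A i\<close> occurs as the \<open>i\<close>-th component of some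
  element of the sum, so commutativity can be read off one summand at a time.
\<close>

lemma commutative_direct_sum_iff:
  assumes ring: "\<And>i. i \<in> I \<Longrightarrow> ring (A i)"
  shows "commutative (direct_sum I A) \<longleftrightarrow> (\<forall>i \<in> I. commutative (A i))"
proof
  assume comm: "commutative (direct_sum I A)"
  show "\<forall>i \<in> I. commutative (A i)"
    unfolding commutative_def
  proof (intro ballI)
    fix i a b assume i: "i \<in> I" and a: "a \<in> carrier (A i)" and b: "b \<in> carrier (A i)"
    define \<iota> where "\<iota> c = (\<lambda>j\<in>I. if j = i then c else \<zero>\<^bsub>A j\<^esub>)" for c
    have \<iota>_closed: "\<iota> c \<in> carrier (direct_sum I A)" if c: "c \<in> carrier (A i)" for c
    proof -
      have "{j \<in> I. \<iota> c j \<noteq> \<zero>\<^bsub>A j\<^esub>} \<subseteq> {i}" by (auto simp: \<iota>_def)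
      then have "finite {j \<in> I. \<iota> c j \<noteq> \<zero>\<^bsub>A j\<^esub>}" by (rule finite_subset) simp
      moreover have "\<iota> c \<in> (\<Pi>\<^sub>E j\<in>I. carrier (A j))"
        using c ring.ring_simprules(2)[OF ring] by (auto simp: \<iota>_def)
      ultimately show ?thesis by (simp add: direct_sum_def)
    qed
    have "\<iota> a \<otimes>\<^bsub>direct_sum I A\<^esub> \<iota> b = \<iota> b \<otimes>\<^bsub>direct_sum I A\<^esub> \<iota> a"
      by (rule commutativeD[OF comm \<iota>_closed[OF a] \<iota>_closed[OF b]])
    then have "(\<iota> a \<otimes>\<^bsub>direct_sum I A\<^esub> \<iota> b) i = (\<iota> b \<otimes>\<^bsub>direct_sum I A\<^esub> \<iota> a) i" by simp
    then show "a \<otimes>\<^bsub>A i\<^esub> b = b \<otimes>\<^bsub>A i\<^esub> a"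
      using i by (simp add: direct_sum_def \<iota>_def)
  qed
next
  assume "\<forall>i \<in> I. commutative (A i)"
  then show "commutative (direct_sum I A)"
    by (auto simp: commutative_def direct_sum_def PiE_iff intro!: restrict_ext)
qed

section \<open>Consequences of commutativity for crossed products\<close>

context crossed_system
begin

lemma monomial_eqD:
  assumes "monomial G A a s = monomial G A b t" "s \<in> arr G" "a \<noteq> \<zero>\<^bsub>A (trg s)\<^esub>"
  shows "s = t" "a = b"
proof -
  have eq: "monomial G A a s s = monomial G A b t s" using assms(1) by simp
  then show "s = t" using assms(2,3) by (auto simp: monomial_def split: if_splits)
  then show "a = b" using eq assms(2) by (simp add: monomial_def)
qed

lemma monomial_coeff_eqD:
  assumes "monomial G A a s = monomial G A b s" "s \<in> arr G"
  shows "a = b"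
  using fun_cong[OF assms(1), of s] assms(2) by (simp add: monomial_def)

text \<open>
  Write \<open>u\<^sub>e\<close> for the monomial of the identity at \<open>e = src s\<close>.  Always \<open>u\<^sub>s u\<^sub>e = u\<^sub>s\<close>, whereas
  \<open>u\<^sub>e u\<^sub>s = 0\<close> as soon as \<open>e \<noteq> trg s\<close>.  Since \<open>\<alpha> s (src s) = 1\<close>, the hypothesis on this value
  says that \<open>1 \<noteq> 0\<close> in the target ring, hence that \<open>u\<^sub>s \<noteq> 0\<close>.
\<close>

lemma src_eq_trg_if_commutative:
  assumes comm: "commutative CP" and s: "s \<in> arr G" and nz: "\<alpha> s (src s) \<noteq> \<zero>\<^bsub>A (trg s)\<^esub>"
  shows "src s = trg s"
proof (rule ccontr)
  assume ne: "src s \<noteq> trg s"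
  let ?u = "\<lambda>r. monomial G A \<one>\<^bsub>A (trg r)\<^esub> r"
  interpret T: ring "A (trg s)" by (rule ring_trg[OF s])
  interpret S: ring "A (src s)" by (rule ring_src[OF s])
  have trg_src_s: "trg (src s) = src s" and src_src_s: "src (src s) = src s"
    by (simp_all add: trg_src src_src s)
  have us: "?u s \<in> carrier CP" by (rule monomial_closed) (simp_all add: s)
  have ue: "?u (src s) \<in> carrier CP" by (rule monomial_closed) (simp_all add: src_arr s trg_src_s)
  have "?u s \<otimes>\<^bsub>CP\<^esub> ?u (src s) = ?u s"
    using monomial_mult[OF s T.one_closed src_arr[OF s], of "\<one>\<^bsub>A (src s)\<^esub>"]
      ring_hom_one[OF \<sigma>_hom[OF s]]
    by (simp add: trg_src_s \<alpha>_src cmp_src s)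
  moreover have "?u (src s) \<otimes>\<^bsub>CP\<^esub> ?u s = \<zero>\<^bsub>CP\<^esub>"
    using monomial_mult[OF src_arr[OF s] _ s T.one_closed, of "\<one>\<^bsub>A (src s)\<^esub>"] ne
    by (simp add: trg_src_s src_src_s)
  ultimately have "?u s s = \<zero>\<^bsub>CP\<^esub> s"
    using commutativeD[OF comm us ue] by simp
  then have "\<one>\<^bsub>A (trg s)\<^esub> = \<zero>\<^bsub>A (trg s)\<^esub>"
    using s by (simp add: monomial_def crossed_product_def)
  then show False using nz \<alpha>_src[OF s] by simp
qed

text \<open>
  All tests with endomorphisms of one object are instances of this equation.
\<close>

lemma monomials_commute_if_commutative:
  assumes comm: "commutative CP"
    and s: "s \<in> arr G" "src s = e" "trg s = e" and t: "t \<in> arr G" "src t = e" "trg t = e"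
    and a: "a \<in> carrier (A e)" and b: "b \<in> carrier (A e)"
  shows "monomial G A (a \<otimes>\<^bsub>A e\<^esub> \<sigma> s b \<otimes>\<^bsub>A e\<^esub> \<alpha> s t) (s \<cdot> t)
    = monomial G A (b \<otimes>\<^bsub>A e\<^esub> \<sigma> t a \<otimes>\<^bsub>A e\<^esub> \<alpha> t s) (t \<cdot> s)"
  using commutativeD[OF comm monomial_closed[of s a] monomial_closed[of t b]]
    monomial_mult[of s a t b] monomial_mult[of t b s a] s t a b
  by simp

text \<open>With \<open>t = e\<close> and \<open>a = 1\<close> the equation reads \<open>\<sigma>\<^sub>s(b) u\<^sub>s = b u\<^sub>s\<close>.\<close>

lemma sigma_trivial_if_commutative:
  assumes comm: "commutative CP" and s: "s \<in> arr G" "src s = e" "trg s = e"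
    and b: "b \<in> carrier (A e)"
  shows "\<sigma> s b = b"
proof -
  have e: "e \<in> ob G" using obI_src[OF s(1)] s(2) by simp
  note e' = ob_arr[OF e] ob_src[OF e] ob_trg[OF e]
  interpret R: ring "A e" by (rule ring_A[OF e])
  have "\<sigma> s b \<in> carrier (A e)" using ring_hom_closed[OF \<sigma>_hom[OF s(1)]] s b by simp
  moreover have "s \<cdot> e = s" "e \<cdot> s = s" "\<alpha> s e = \<one>\<^bsub>A e\<^esub>" "\<alpha> e s = \<one>\<^bsub>A e\<^esub>"
    using cmp_src[OF s(1)] trg_cmp_self[OF s(1)] \<alpha>_src[OF s(1)] \<alpha>_trg[OF s(1)] s by simp_all
  ultimately have "monomial G A (\<sigma> s b) s = monomial G A b s"
    using monomials_commute_if_commutative[OF comm s e' R.one_closed b] \<sigma>_ob[OF e R.one_closed] b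
    by simp
  then show ?thesis using s(1) by (rule monomial_coeff_eqD)
qed

text \<open>With \<open>s = t = e\<close> it reads \<open>(a b) u\<^sub>e = (b a) u\<^sub>e\<close>: the ring \<open>A e\<close> embeds as \<open>A e u\<^sub>e\<close>.\<close>

lemma commutative_coefficients_if_commutative:
  assumes comm: "commutative CP" and e: "e \<in> ob G"
  shows "commutative (A e)"
  unfolding commutative_def
proof (intro ballI)
  fix a b assume a: "a \<in> carrier (A e)" and b: "b \<in> carrier (A e)"
  note e' = ob_arr[OF e] ob_src[OF e] ob_trg[OF e]
  interpret R: ring "A e" by (rule ring_A[OF e])
  have "\<alpha> e e = \<one>\<^bsub>A e\<^esub>" "e \<cdot> e = e" using \<alpha>_src[OF e'(1)] cmp_src[OF e'(1)] e' by simp_all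
  then have "monomial G A (a \<otimes>\<^bsub>A e\<^esub> b) e = monomial G A (b \<otimes>\<^bsub>A e\<^esub> a) e"
    using monomials_commute_if_commutative[OF comm e' e' a b] \<sigma>_ob[OF e] a b by simp
  then show "a \<otimes>\<^bsub>A e\<^esub> b = b \<otimes>\<^bsub>A e\<^esub> a" using e'(1) by (rule monomial_coeff_eqD)
qed

text \<open>
  With \<open>a = b = 1\<close> it reads \<open>\<alpha>(s,t) u\<^sub>s\<^sub>t = \<alpha>(t,s) u\<^sub>t\<^sub>s\<close>.  If both coefficients were zero, nothing
  would follow about \<open>s \<cdot> t\<close> and \<open>t \<cdot> s\<close>; one nonzero coefficient forces the supports to coincide.
\<close>

lemma endomorphisms_commute_if_commutative:
  assumes comm: "commutative CP"
    and s: "s \<in> arr G" "src s = e" "trg s = e" and t: "t \<in> arr G" "src t = e" "trg t = e"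
    and nz: "\<alpha> s t \<noteq> \<zero>\<^bsub>A e\<^esub>"
  shows "s \<cdot> t = t \<cdot> s" "\<alpha> s t = \<alpha> t s"
proof -
  interpret R: ring "A e" using ring_src[OF s(1)] s(2) by simp
  have \<alpha>: "\<alpha> s t \<in> carrier (A e)" "\<alpha> t s \<in> carrier (A e)"
    using \<alpha>_closed[of s t] \<alpha>_closed[of t s] s t by (auto simp: composable_def)
  have \<sigma>: "\<sigma> s \<one>\<^bsub>A e\<^esub> = \<one>\<^bsub>A e\<^esub>" "\<sigma> t \<one>\<^bsub>A e\<^esub> = \<one>\<^bsub>A e\<^esub>"
    using ring_hom_one[OF \<sigma>_hom[OF s(1)]] ring_hom_one[OF \<sigma>_hom[OF t(1)]] s t by simp_all
  have eq: "monomial G A (\<alpha> s t) (s \<cdot> t) = monomial G A (\<alpha> t s) (t \<cdot> s)"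
    using monomials_commute_if_commutative[OF comm s t R.one_closed R.one_closed] \<alpha> \<sigma> by simp
  have st: "s \<cdot> t \<in> arr G" "trg (s \<cdot> t) = e" using cmp_arr trg_cmp s t by simp_all
  show "s \<cdot> t = t \<cdot> s" "\<alpha> s t = \<alpha> t s"
    using monomial_eqD[OF eq st(1)] nz st(2) by simp_all
qed

section \<open>Sufficient conditions for commutativity\<close>

text \<open>
  The conditions enter one factor at a time: \<open>x\<^sub>s \<sigma>\<^sub>s(y\<^sub>t) \<alpha>(s,t) = x\<^sub>s y\<^sub>t \<alpha>(s,t) =
  y\<^sub>t x\<^sub>s \<alpha>(t,s) = y\<^sub>t \<sigma>\<^sub>t(x\<^sub>s) \<alpha>(t,s)\<close>, where all factors lie in the same ring since \<open>s\<close> and \<open>t\<close> are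
  endomorphisms of one object.  As also \<open>s \<cdot> t = t \<cdot> s\<close>, exchanging \<open>s\<close> and \<open>t\<close> is a symmetry of
  the sum that defines a coefficient of the product.
\<close>

lemma commutative_if_factors_commute:
  assumes endo: "\<And>s. s \<in> arr G \<Longrightarrow> src s = trg s"
    and comm_G: "\<And>s t. (s, t) \<in> composable G \<Longrightarrow> s \<cdot> t = t \<cdot> s"
    and comm_A: "\<And>e. e \<in> ob G \<Longrightarrow> commutative (A e)"
    and triv: "\<And>s a. \<lbrakk>s \<in> arr G; a \<in> carrier (A (src s))\<rbrakk> \<Longrightarrow> \<sigma> s a = a"
    and sym: "\<And>s t. (s, t) \<in> composable G \<Longrightarrow> \<alpha> s t = \<alpha> t s"
  shows "commutative CP"
  unfolding commutative_def
proof (intro ballI)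
  fix x y assume x: "x \<in> carrier CP" and y: "y \<in> carrier CP"
  \<comment> \<open>Both products are taken over one finite set of morphisms, so that the index set of the
    sum is invariant under the swap.\<close>
  define S where "S = {s \<in> arr G. x s \<noteq> \<zero>\<^bsub>A (trg s)\<^esub>} \<union> {s \<in> arr G. y s \<noteq> \<zero>\<^bsub>A (trg s)\<^esub>}"
  have fin: "finite S" using finite_supp x y by (simp add: S_def)
  have swap: "(t, s) \<in> composable G" if "(s, t) \<in> composable G" for s t
    using that endo by (auto simp: composable_def)
  show "x \<otimes>\<^bsub>CP\<^esub> y = y \<otimes>\<^bsub>CP\<^esub> x"
  proof (rule extensionalityI[of _ "arr G"])
    show "x \<otimes>\<^bsub>CP\<^esub> y \<in> extensional (arr G)" "y \<otimes>\<^bsub>CP\<^esub> x \<in> extensional (arr G)"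
      by (simp_all add: crossed_product_def)
  next
    fix r assume r: "r \<in> arr G"
    interpret R: ring "A (trg r)" by (rule ring_trg[OF r])
    let ?P = "{(s, t) \<in> composable G. s \<cdot> t = r \<and> s \<in> S \<and> t \<in> S}"
    define f where "f u v p =
      u (fst p) \<otimes>\<^bsub>A (trg r)\<^esub> \<sigma> (fst p) (v (snd p)) \<otimes>\<^bsub>A (trg r)\<^esub> \<alpha> (fst p) (snd p)" for u v p
    have summand: "f x y p \<in> carrier (A (trg r)) \<and> f y x (prod.swap p) = f x y p"
      if "p \<in> ?P" for p
    proof -
      obtain s t where p: "p = (s, t)" by (cases p)
      with that have c: "(s, t) \<in> composable G" and st: "s \<cdot> t = r" by auto
      then have arr: "s \<in> arr G" "t \<in> arr G" by (auto simp: composable_def)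
      have tr: "trg s = trg r" using trg_cmp[of s t] c st by (auto simp: composable_def)
      with c have ends: "src s = trg r" "trg t = trg r" "src t = trg r"
        using endo arr by (auto simp: composable_def)
      have cl: "x s \<in> carrier (A (trg r))" "y t \<in> carrier (A (trg r))"
        using coeff_closed[OF x arr(1)] coeff_closed[OF y arr(2)] tr ends by simp_all
      have \<sigma>: "\<sigma> s (y t) = y t" "\<sigma> t (x s) = x s" using triv arr ends cl by simp_all
      have \<alpha>: "\<alpha> s t \<in> carrier (A (trg r))" using \<alpha>_closed[OF c] tr by simp
      have "x s \<otimes>\<^bsub>A (trg r)\<^esub> y t = y t \<otimes>\<^bsub>A (trg r)\<^esub> x s"
        by (rule commutativeD[OF comm_A[OF obI_trg[OF r]] cl])
      then show ?thesis using cl \<sigma> \<alpha> sym[OF c] by (simp add: p f_def)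
    qed
    have inv: "prod.swap ` ?P = ?P"
    proof -
      have sub: "prod.swap ` ?P \<subseteq> ?P" using swap comm_G by auto
      from image_mono[OF this, of prod.swap] have "?P \<subseteq> prod.swap ` ?P"
        by (simp add: image_image)
      with sub show ?thesis by (rule subset_antisym)
    qed
    have "(y \<otimes>\<^bsub>CP\<^esub> x) r = finsum (A (trg r)) (f y x) ?P"
      unfolding f_def by (rule mult_eq_finsum[OF y x r fin fin]) (auto simp: S_def)
    also have "\<dots> = finsum (A (trg r)) (f y x) (prod.swap ` ?P)"
      by (simp only: inv)
    also have "\<dots> = finsum (A (trg r)) (\<lambda>p. f y x (prod.swap p)) ?P"
    proof (rule R.finsum_reindex)
      show "f y x \<in> prod.swap ` ?P \<rightarrow> carrier (A (trg r))"
        by (rule Pi_I, erule imageE) (simp only: summand)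
    qed simp
    also have "\<dots> = finsum (A (trg r)) (f x y) ?P"
      by (rule R.finsum_cong'[OF refl]) (rule Pi_I, simp only: summand, simp only: summand)
    also have "\<dots> = (x \<otimes>\<^bsub>CP\<^esub> y) r"
      unfolding f_def by (rule mult_eq_finsum[OF x y r fin fin, symmetric]) (auto simp: S_def)
    finally show "(x \<otimes>\<^bsub>CP\<^esub> y) r = (y \<otimes>\<^bsub>CP\<^esub> x) r" ..
  qed
qed

end

section \<open>Characterisation of commutative crossed products\<close>

theorem proposition3:
  fixes G :: "('g, 'k) cat_scheme"
    and A :: "'g \<Rightarrow> ('a, 'm) ring_scheme"
    and \<sigma> :: "'g \<Rightarrow> 'a \<Rightarrow> 'a"
    and \<alpha> :: "'g \<Rightarrow> 'g \<Rightarrow> 'a"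
  assumes "crossed_system G A \<sigma> \<alpha>"
  shows "((\<forall>(s, t) \<in> composable G. \<alpha> s t \<noteq> \<zero>\<^bsub>A (trg\<^bsub>G\<^esub> s)\<^esub>) \<and>
          commutative (crossed_product G A \<sigma> \<alpha>) \<longrightarrow>
            (disjoint_union_of_vertex_monoids G \<and>
             (\<forall>e \<in> ob G. comm_monoid (vertex_monoid G e))) \<and>
            (\<forall>e \<in> ob G. twisted_monoid_algebra (vertex_category G e) A \<sigma> \<alpha>) \<and>
            commutative (direct_sum (ob G) A) \<and>
            symmetric_twist G \<alpha>) \<and>
         ((disjoint_union_of_vertex_monoids G \<and>
           (\<forall>e \<in> ob G. comm_monoid (vertex_monoid G e))) \<and>
          (\<forall>e \<in> ob G. twisted_monoid_algebra (vertex_category G e) A \<sigma> \<alpha>) \<and>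
          commutative (direct_sum (ob G) A) \<and>
          symmetric_twist G \<alpha> \<longrightarrow>
            commutative (crossed_product G A \<sigma> \<alpha>))"
proof -
  interpret crossed_system G A \<sigma> \<alpha> by fact
  have vertex: "s \<in> carrier (vertex_monoid G e) \<longleftrightarrow> s \<in> arr G \<and> src\<^bsub>G\<^esub> s = e \<and> trg\<^bsub>G\<^esub> s = e"
    for s e by (simp add: vertex_monoid_def)
  have vertex_mult: "mult (vertex_monoid G e) = cmp G" for e
    by (simp add: vertex_monoid_def)
  have vertex_src: "src\<^bsub>vertex_category G e\<^esub> = src\<^bsub>G\<^esub>" and
    vertex_arr: "arr (vertex_category G e) = carrier (vertex_monoid G e)" for e
    by (simp_all add: vertex_category_def)
  note twisted = twisted_monoid_algebra_def vertex_src vertex_arr vertex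
  note A_iff = commutative_direct_sum_iff[OF ring_A]
  show ?thesis
  proof (intro conjI impI; elim conjE)
    assume nz: "\<forall>(s, t) \<in> composable G. \<alpha> s t \<noteq> \<zero>\<^bsub>A (trg\<^bsub>G\<^esub> s)\<^esub>"
      and comm: "commutative CP"
    have nz': "\<alpha> s t \<noteq> \<zero>\<^bsub>A (trg\<^bsub>G\<^esub> s)\<^esub>"
      if "s \<in> arr G" "t \<in> arr G" "src\<^bsub>G\<^esub> s = trg\<^bsub>G\<^esub> t" for s t
      using nz that by (auto simp: composable_def)
    show "disjoint_union_of_vertex_monoids G"
      unfolding disjoint_union_of_vertex_monoids_iff
      using src_eq_trg_if_commutative[OF comm] nz' by (simp add: src_arr trg_src)
    show "\<forall>e \<in> ob G. comm_monoid (vertex_monoid G e)"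
    proof
      fix e assume e: "e \<in> ob G"
      show "comm_monoid (vertex_monoid G e)"
      proof (rule monoid.monoid_comm_monoidI[OF vertex_monoid_is_monoid[OF e]])
        fix s t assume "s \<in> carrier (vertex_monoid G e)" "t \<in> carrier (vertex_monoid G e)"
        then show "s \<otimes>\<^bsub>vertex_monoid G e\<^esub> t = t \<otimes>\<^bsub>vertex_monoid G e\<^esub> s"
          unfolding vertex vertex_mult
          by (metis endomorphisms_commute_if_commutative(1)[OF comm] nz')
      qed
    qed
    show "\<forall>e \<in> ob G. twisted_monoid_algebra (vertex_category G e) A \<sigma> \<alpha>"
      using sigma_trivial_if_commutative[OF comm]
      by (auto simp: twisted crossed_system_vertex ob_vertex_category)
    show "commutative (direct_sum (ob G) A)"
      using commutative_coefficients_if_commutative[OF comm] by (simp add: A_iff)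
    show "symmetric_twist G \<alpha>"
      unfolding symmetric_twist_def
    proof (intro ballI)
      fix e s t
      assume "s \<in> carrier (vertex_monoid G e)" "t \<in> carrier (vertex_monoid G e)"
      then show "\<alpha> s t = \<alpha> t s"
        unfolding vertex by (metis endomorphisms_commute_if_commutative(2)[OF comm] nz')
    qed
  next
    assume U: "disjoint_union_of_vertex_monoids G"
      and ab: "\<forall>e \<in> ob G. comm_monoid (vertex_monoid G e)"
      and tw: "\<forall>e \<in> ob G. twisted_monoid_algebra (vertex_category G e) A \<sigma> \<alpha>"
      and A: "commutative (direct_sum (ob G) A)"
      and sym: "symmetric_twist G \<alpha>"
    have endo: "src\<^bsub>G\<^esub> s = trg\<^bsub>G\<^esub> s" if "s \<in> arr G" for s
      using U that by (simp add: disjoint_union_of_vertex_monoids_iff)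
    have mem: "s \<in> carrier (vertex_monoid G (trg\<^bsub>G\<^esub> s))" if "s \<in> arr G" for s
      using endo that by (simp add: vertex)
    have mem2: "trg\<^bsub>G\<^esub> s \<in> ob G \<and> s \<in> carrier (vertex_monoid G (trg\<^bsub>G\<^esub> s)) \<and>
        t \<in> carrier (vertex_monoid G (trg\<^bsub>G\<^esub> s))"
      if "(s, t) \<in> composable G" for s t
      using that endo[of s] mem[of s] mem[of t] obI_trg[of s] by (auto simp: composable_def)
    show "commutative CP"
    proof (rule commutative_if_factors_commute)
      show "cmp G s t = cmp G t s" if "(s, t) \<in> composable G" for s t
        using comm_monoid.m_comm[of "vertex_monoid G (trg\<^bsub>G\<^esub> s)" s t] ab mem2[OF that]
        by (simp add: vertex_mult)
      show "\<alpha> s t = \<alpha> t s" if "(s, t) \<in> composable G" for s t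
        using sym mem2[OF that] by (auto simp: symmetric_twist_def)
      show "commutative (A e)" if "e \<in> ob G" for e
        using A that by (simp add: A_iff)
      show "\<sigma> s a = a" if "s \<in> arr G" "a \<in> carrier (A (src\<^bsub>G\<^esub> s))" for s a
        using tw obI_src[OF that(1)] endo[OF that(1)] that by (auto simp: twisted)
    qed (rule endo)
  qed
qed

end
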